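(* Let $m<n$ be integers. For $p_{m-1},p_m,\dots,p_n\in(0,1)$, let $\mu_{m,n}$ be the unique stationary distribution of the exclusion process on $[m,n]=\{m,\dots,n\}$ with boundary conditions determined by $p_{m-1},\dots,p_n$, and let $\phi(\mu_{m,n})$ be its flux. Then $\phi(\mu_{m,n})$ is an increasing function of $p_{m-1},p_m,\dots,p_n$; that is, if $p_i\le p_i'$ for all $m-1\le i\le n$ (all in $(0,1)$), and $\mu_{m,n}'$ denotes the stationary distribution corresponding to $p_{m-1}',\dots,p_n'$, then $\phi(\mu_{m,n}')\ge\phi(\mu_{m,n})$, where each flux is computed with its own jump probabilities.
   Context: Write $q_i=1-p_i$. The exclusion process on $[m,n]$ with boundary conditions is the continuous time Markov chain on $\{0,1\}^{[m,n]}$ with the following transitions: for each $m\le i<n$, a particle at $i$ jumps to $i+1$ at rate $p_i$ if $\eta(i)=1,\eta(i+1)=0$, and a particle at $i+1$ jumps to $i$ at rate $q_{i+1}$ if $\eta(i)=0,\eta(i+1)=1$; in addition, the value at site $m$ changes $0\to1$ at rate $p_{m-1}$, and the value at site $n$ changes $1\to0$ at rate $p_n$. This is a finite state irreducible Markov chain, hence it has a unique stationary distribution $\mu_{m,n}$. Its flux is $$\phi(\mu_{m,n})=p_k\,\mu_{m,n}\{\eta:\eta(k)=1,\eta(k+1)=0\}-q_{k+1}\,\mu_{m,n}\{\eta:\eta(k)=0,\eta(k+1)=1\},$$ which does not depend on $k$ with $m\le k<n$. *)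

theory Defs
  imports "HOL-Probability.Probability"
begin

definition configs :: "int \<Rightarrow> int \<Rightarrow> (int \<Rightarrow> nat) set" where
  "configs m n = {m..n} \<rightarrow>\<^sub>E {0, 1}"

text \<open>
  Jump rate from \<open>\<eta>\<close> to \<open>\<zeta>\<close> in the exclusion process on \<open>[m,n]\<close> with boundary conditions.
  Only the values of \<open>p\<close> on \<open>{m-1..n}\<close> are used. For \<open>m < n\<close> and a configuration \<open>\<eta>\<close> at most
  one of the summands is nonzero, since the listed transitions out of \<open>\<eta>\<close> have distinct targets.
\<close>

definition excl_rate :: "int \<Rightarrow> int \<Rightarrow> (int \<Rightarrow> real) \<Rightarrow> (int \<Rightarrow> nat) \<Rightarrow> (int \<Rightarrow> nat) \<Rightarrow> real" where
  "excl_rate m n p \<eta> \<zeta> =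
     (\<Sum>i\<in>{m..<n}.
        (if \<eta> i = 1 \<and> \<eta> (i + 1) = 0 \<and> \<zeta> = \<eta>(i := 0, i + 1 := 1) then p i else 0)
      + (if \<eta> i = 0 \<and> \<eta> (i + 1) = 1 \<and> \<zeta> = \<eta>(i := 1, i + 1 := 0) then 1 - p (i + 1) else 0))
   + (if \<eta> m = 0 \<and> \<zeta> = \<eta>(m := 1) then p (m - 1) else 0)
   + (if \<eta> n = 1 \<and> \<zeta> = \<eta>(n := 0) then p n else 0)"

text \<open>The Q-matrix of the chain, with row sums zero.\<close>

definition excl_generator ::
  "int \<Rightarrow> int \<Rightarrow> (int \<Rightarrow> real) \<Rightarrow> (int \<Rightarrow> nat) \<Rightarrow> (int \<Rightarrow> nat) \<Rightarrow> real" where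
  "excl_generator m n p \<eta> \<zeta> =
     (if \<eta> = \<zeta> then - (\<Sum>\<xi>\<in>configs m n - {\<eta>}. excl_rate m n p \<eta> \<xi>) else excl_rate m n p \<eta> \<zeta>)"

text \<open>A probability distribution \<open>\<mu>\<close> on the state space with \<open>\<mu> Q = 0\<close>.\<close>

definition stationary_distribution ::
  "int \<Rightarrow> int \<Rightarrow> (int \<Rightarrow> real) \<Rightarrow> (int \<Rightarrow> nat) pmf \<Rightarrow> bool" where
  "stationary_distribution m n p \<mu> \<longleftrightarrow>
     set_pmf \<mu> \<subseteq> configs m n \<and>
     (\<forall>\<zeta>\<in>configs m n. (\<Sum>\<eta>\<in>configs m n. pmf \<mu> \<eta> * excl_generator m n p \<eta> \<zeta>) = 0)"

text \<open>
  The flux through the bond \<open>(k, k+1)\<close>. For stationary \<open>\<mu>\<close> on \<open>[m,n]\<close> its value does not depend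
  on \<open>k\<close> with \<open>m \<le> k < n\<close>; this is the flux of \<open>\<mu>\<close>.
\<close>

definition flux :: "(int \<Rightarrow> real) \<Rightarrow> (int \<Rightarrow> nat) pmf \<Rightarrow> int \<Rightarrow> real" where
  "flux p \<mu> k =
     p k * measure_pmf.prob \<mu> {\<eta>. \<eta> k = 1 \<and> \<eta> (k + 1) = 0}
     - (1 - p (k + 1)) * measure_pmf.prob \<mu> {\<eta>. \<eta> k = 0 \<and> \<eta> (k + 1) = 1}"

end

theory Submission
  imports Defs
begin

text \<open>
  The idea is to couple the two processes through their height functions. Encode a configuration
  \<open>\<eta>\<close> by integers \<open>h x\<close>, \<open>m - 1 \<le> x \<le> n\<close>, with \<open>h (x - 1) - h x = \<eta> x\<close>. A particle that crosses the
  bond \<open>(i, i + 1)\<close> to the right raises \<open>h i\<close> by one, a particle that crosses it to the left lowers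
  \<open>h i\<close> by one; entrance at \<open>m\<close> and exit at \<open>n\<close> raise \<open>h (m - 1)\<close> and \<open>h n\<close>. So \<open>h r\<close> counts the net
  number of crossings of the bond \<open>(r, r + 1)\<close>, and the flux is the growth rate of the height.

  Every elementary move is a monotone map on height functions (\<open>up_mono\<close>, \<open>down_mono\<close>). Moves up
  have the rates \<open>p i\<close> and moves down the rates \<open>1 - p (i + 1)\<close>, so larger parameters make
  the height grow faster.

  No continuous-time process is needed for this. The averaging operator \<open>step p\<close> on functions of the
  height is the transition operator of the chain in discrete time, where every elementary move is
  proposed with the same probability. It preserves monotone functions and increases with \<open>p\<close>
  (\<open>step_le\<close>); hence so does the expected height \<open>mean_height p t\<close> after \<open>t\<close> steps, as a function of
  the initial height. If the initial configuration has the stationary distribution, then each step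
  raises the expectation by the flux through the bond \<open>(r, r + 1)\<close> at which the initial height is
  normalized to zero, up to a constant factor (\<open>expectation_mean_height\<close>). The initial heights of
  any two configurations differ by a bounded amount. Letting \<open>t\<close> tend to infinity compares the two
  fluxes, also when they are measured at different bonds.
\<close>

section \<open>Height functions and their monotone dynamics\<close>

locale height_process =
  fixes m n :: int
  assumes m_less_n: "m < n"
begin

text \<open>The pointwise order on the sites \<open>{m - 1..n}\<close>; other values are ignored.\<close>

definition height_le :: "(int \<Rightarrow> int) \<Rightarrow> (int \<Rightarrow> int) \<Rightarrow> bool" (infix "\<sqsubseteq>" 50) where
  "h \<sqsubseteq> h' \<longleftrightarrow> (\<forall>x\<in>{m - 1..n}. h x \<le> h' x)"

text \<open>
  The crossing of the bond \<open>(i, i + 1)\<close> to the right, if it is possible. If \<open>h\<close> encodes a configuration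
  \<open>\<eta>\<close>, then \<open>h i < h (i - 1)\<close> says \<open>\<eta> i = 1\<close> and \<open>h i \<le> h (i + 1)\<close> says \<open>\<eta> (i + 1) = 0\<close>. With
  inequalities in place of equations, the map is monotone on all integer-valued functions. The
  cases \<open>i = m - 1\<close> and \<open>i = n\<close> are entrance and exit.
\<close>

definition up :: "int \<Rightarrow> (int \<Rightarrow> int) \<Rightarrow> int \<Rightarrow> int" where
  "up i h = (if (i = m - 1 \<or> h i < h (i - 1)) \<and> (i = n \<or> h i \<le> h (i + 1))
             then h(i := h i + 1) else h)"

text \<open>The crossing of the bond \<open>(i, i + 1)\<close> to the left, used only for \<open>m \<le> i < n\<close>.\<close>

definition down :: "int \<Rightarrow> (int \<Rightarrow> int) \<Rightarrow> int \<Rightarrow> int" where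
  "down i h = (if h (i - 1) \<le> h i \<and> h (i + 1) < h i then h(i := h i - 1) else h)"

lemma height_le_refl: "h \<sqsubseteq> h"
  by (simp add: height_le_def)

lemma le_up: "h \<sqsubseteq> up i h"
  by (simp add: height_le_def up_def)

lemma down_le: "down i h \<sqsubseteq> h"
  by (simp add: height_le_def down_def)

lemma up_mono:
  assumes "h \<sqsubseteq> h'" and "m - 1 \<le> i" "i \<le> n"
  shows "up i h \<sqsubseteq> up i h'"
proof -
  have le: "h x \<le> h' x" if "m - 1 \<le> x" "x \<le> n" for x
    using assms(1) that by (simp add: height_le_def)
  have "up i h x \<le> up i h' x" if x: "m - 1 \<le> x" "x \<le> n" for x
  proof (cases "x = i \<and> h i = h' i")
    case True
    \<comment> \<open>Only at a tie can the move of \<open>h\<close> break the order; then \<open>h'\<close> can make the same move.\<close>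
    have "i = m - 1 \<or> h (i - 1) \<le> h' (i - 1)" using le[of "i - 1"] assms by fastforce
    moreover have "i = n \<or> h (i + 1) \<le> h' (i + 1)" using le[of "i + 1"] assms by fastforce
    ultimately show ?thesis using True by (auto simp: up_def)
  next
    case False
    with le[OF x] show ?thesis by (auto simp: up_def)
  qed
  then show ?thesis by (simp add: height_le_def)
qed

lemma down_mono:
  assumes "h \<sqsubseteq> h'" and "m \<le> i" "i < n"
  shows "down i h \<sqsubseteq> down i h'"
proof -
  have le: "h x \<le> h' x" if "m - 1 \<le> x" "x \<le> n" for x
    using assms(1) that by (simp add: height_le_def)
  have "down i h x \<le> down i h' x" if x: "m - 1 \<le> x" "x \<le> n" for x
  proof (cases "x = i \<and> h i = h' i")
    case True
    \<comment> \<open>At a tie, if \<open>h'\<close> can move down, then so can \<open>h\<close>.\<close>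
    with le[of "i - 1"] le[of "i + 1"] assms show ?thesis by (auto simp: down_def)
  next
    case False
    with le[OF x] show ?thesis by (auto simp: down_def)
  qed
  then show ?thesis by (simp add: height_le_def)
qed

lemma up_shift: "up i (\<lambda>x. h x + c) = (\<lambda>x. up i h x + c)"
  by (auto simp: up_def fun_eq_iff)

lemma down_shift: "down i (\<lambda>x. h x + c) = (\<lambda>x. down i h x + c)"
  by (auto simp: down_def fun_eq_iff)

section \<open>The discrete-time transition operator\<close>

text \<open>
  Monotone functions of the height that follow a vertical shift of the height. Monotonicity with
  respect to \<open>\<sqsubseteq>\<close> includes that the values outside \<open>{m - 1..n}\<close> do not matter.
\<close>

definition observable :: "((int \<Rightarrow> int) \<Rightarrow> real) \<Rightarrow> bool" where
  "observable f \<longleftrightarrow> (\<forall>h h'. h \<sqsubseteq> h' \<longrightarrow> f h \<le> f h') \<and>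
     (\<forall>h (c :: int). f (\<lambda>x. h x + c) = f h + c)"

lemma observable_mono: "observable f \<Longrightarrow> h \<sqsubseteq> h' \<Longrightarrow> f h \<le> f h'"
  by (simp add: observable_def)

lemma observable_shift: "observable f \<Longrightarrow> f (\<lambda>x. h x + c) = f h + of_int c"
  by (simp add: observable_def)

lemma observable_eq:
  assumes "observable f" and "\<And>x. m - 1 \<le> x \<Longrightarrow> x \<le> n \<Longrightarrow> h x = h' x + c"
  shows "f h = f h' + of_int c"
proof -
  have "f h = f (\<lambda>x. h' x + c)"
    by (rule antisym; rule observable_mono[OF assms(1)]) (simp_all add: height_le_def assms(2))
  then show ?thesis by (simp add: observable_shift[OF assms(1)])
qed

text \<open>The number of elementary moves: \<open>n - m + 2\<close> moves up and \<open>n - m\<close> moves down.\<close>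

definition num_moves :: real where
  "num_moves = of_int (n - m + 2) + of_int (n - m)"

lemma num_moves_pos: "num_moves > 0"
  using m_less_n by (simp add: num_moves_def)

lemma sum_moves_shift:
  fixes F G :: "int \<Rightarrow> real"
  shows "(\<Sum>i\<in>{m - 1..n}. F i + c) + (\<Sum>i\<in>{m..<n}. G i + c) =
    (\<Sum>i\<in>{m - 1..n}. F i) + (\<Sum>i\<in>{m..<n}. G i) + num_moves * c"
  using m_less_n by (simp add: sum.distrib num_moves_def algebra_simps)

text \<open>
  A move is chosen uniformly and carried out with the probability that equals its rate. Convex
  combinations make the monotonicity visible term by term.
\<close>

definition step :: "(int \<Rightarrow> real) \<Rightarrow> ((int \<Rightarrow> int) \<Rightarrow> real) \<Rightarrow> (int \<Rightarrow> int) \<Rightarrow> real" where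
  "step p f h =
     ((\<Sum>i\<in>{m - 1..n}. (1 - p i) * f h + p i * f (up i h)) +
      (\<Sum>i\<in>{m..<n}. p (i + 1) * f h + (1 - p (i + 1)) * f (down i h))) / num_moves"

lemma convex_combination_le:
  fixes a b a' b' s s' :: real
  assumes "a \<le> a'" "b \<le> b'" "a \<le> b" "0 \<le> s'" "s' \<le> 1" "s \<le> s'"
  shows "(1 - s) * a + s * b \<le> (1 - s') * a' + s' * b'"
proof -
  have "(1 - s) * a + s * b = a + s * (b - a)" by (simp add: algebra_simps)
  also have "\<dots> \<le> a + s' * (b - a)" using assms by (simp add: mult_right_mono)
  also have "\<dots> = (1 - s') * a + s' * b" by (simp add: algebra_simps)
  also have "\<dots> \<le> (1 - s') * a' + s' * b'"
    using assms by (intro add_mono mult_left_mono) simp_all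
  finally show ?thesis .
qed

lemma step_le:
  assumes f: "observable f" and f': "\<And>h. f h \<le> f' h" and h: "h \<sqsubseteq> h'"
    and "\<And>i. m - 1 \<le> i \<Longrightarrow> i \<le> n \<Longrightarrow> p' i \<in> {0<..<1}"
    and "\<And>i. m - 1 \<le> i \<Longrightarrow> i \<le> n \<Longrightarrow> p i \<le> p' i"
  shows "step p f h \<le> step p' f' h'"
proof -
  have le: "f g \<le> f' g'" if "g \<sqsubseteq> g'" for g g'
    using observable_mono[OF f that] f'[of g'] by linarith
  have "(1 - p i) * f h + p i * f (up i h) \<le> (1 - p' i) * f' h' + p' i * f' (up i h')"
    if "i \<in> {m - 1..n}" for i
    using that assms(4,5)[of i]
    by (intro convex_combination_le le h up_mono observable_mono[OF f] le_up) auto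
  moreover have "p (i + 1) * f h + (1 - p (i + 1)) * f (down i h)
      \<le> p' (i + 1) * f' h' + (1 - p' (i + 1)) * f' (down i h')"
    if "i \<in> {m..<n}" for i
    using that assms(4,5)[of "i + 1"]
      convex_combination_le[of "f (down i h)" "f' (down i h')" "f h" "f' h'" "p' (i + 1)" "p (i + 1)"]
      le[OF h] le[OF down_mono[OF h]] observable_mono[OF f down_le]
    by (auto simp: add.commute)
  ultimately show ?thesis
    unfolding step_def using num_moves_pos
    by (intro divide_right_mono add_mono[OF sum_mono sum_mono]) auto
qed

lemma observable_step:
  assumes f: "observable f" and p: "\<And>i. m - 1 \<le> i \<Longrightarrow> i \<le> n \<Longrightarrow> p i \<in> {0<..<1}"
  shows "observable (step p f)"
proof -
  have "step p f h \<le> step p f h'" if "h \<sqsubseteq> h'" for h h'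
    by (rule step_le) (use that f p in auto)
  moreover have "step p f (\<lambda>x. h x + c) = step p f h + of_int c" for h c
  proof -
    have up: "(1 - p i) * f (\<lambda>x. h x + c) + p i * f (up i (\<lambda>x. h x + c))
        = ((1 - p i) * f h + p i * f (up i h)) + of_int c" for i
      unfolding up_shift observable_shift[OF f] by (simp add: algebra_simps)
    have down: "p (i + 1) * f (\<lambda>x. h x + c) + (1 - p (i + 1)) * f (down i (\<lambda>x. h x + c))
        = (p (i + 1) * f h + (1 - p (i + 1)) * f (down i h)) + of_int c" for i
      unfolding down_shift observable_shift[OF f] by (simp add: algebra_simps)
    have "step p f (\<lambda>x. h x + c) =
       (((\<Sum>i\<in>{m - 1..n}. (1 - p i) * f h + p i * f (up i h)) +
        (\<Sum>i\<in>{m..<n}. p (i + 1) * f h + (1 - p (i + 1)) * f (down i h)))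
        + num_moves * of_int c) / num_moves"
      unfolding step_def up down sum_moves_shift ..
    also have "\<dots> = step p f h + of_int c"
      unfolding step_def using num_moves_pos by (simp add: add_divide_distrib)
    finally show ?thesis .
  qed
  ultimately show ?thesis by (simp add: observable_def)
qed

text \<open>
  The expected height at the site \<open>m\<close> after \<open>t\<close> steps, as a function of the initial height. The
  choice of the site is immaterial.
\<close>

definition mean_height :: "(int \<Rightarrow> real) \<Rightarrow> nat \<Rightarrow> (int \<Rightarrow> int) \<Rightarrow> real" where
  "mean_height p t = (step p ^^ t) (\<lambda>h. of_int (h m))"

lemma mean_height_Suc: "mean_height p (Suc t) = step p (mean_height p t)"
  by (simp add: mean_height_def)

lemma observable_mean_height:
  assumes "\<And>i. m - 1 \<le> i \<Longrightarrow> i \<le> n \<Longrightarrow> p i \<in> {0<..<1}"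
  shows "observable (mean_height p t)"
proof (induction t)
  case 0
  show ?case using m_less_n by (simp add: mean_height_def observable_def height_le_def)
next
  case (Suc t)
  then show ?case using assms by (simp add: mean_height_Suc observable_step)
qed

lemma mean_height_le:
  assumes "\<And>i. m - 1 \<le> i \<Longrightarrow> i \<le> n \<Longrightarrow> p i \<in> {0<..<1}"
    and "\<And>i. m - 1 \<le> i \<Longrightarrow> i \<le> n \<Longrightarrow> p' i \<in> {0<..<1}"
    and "\<And>i. m - 1 \<le> i \<Longrightarrow> i \<le> n \<Longrightarrow> p i \<le> p' i"
  shows "mean_height p t h \<le> mean_height p' t h"
proof (induction t arbitrary: h)
  case 0
  show ?case by (simp add: mean_height_def)
next
  case (Suc t)
  show ?case unfolding mean_height_Suc
    by (rule step_le[OF observable_mean_height Suc height_le_refl]) (use assms in auto)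
qed

section \<open>Moves of configurations\<close>

text \<open>
  The moves of configurations that correspond to \<open>up i\<close> and \<open>down i\<close>. A move that is not possible
  leaves the configuration unchanged.
\<close>

definition jump_right :: "int \<Rightarrow> (int \<Rightarrow> nat) \<Rightarrow> int \<Rightarrow> nat" where
  "jump_right i \<eta> =
     (if i = m - 1 then (if \<eta> m = 0 then \<eta>(m := 1) else \<eta>)
      else if i = n then (if \<eta> n = 1 then \<eta>(n := 0) else \<eta>)
      else if \<eta> i = 1 \<and> \<eta> (i + 1) = 0 then \<eta>(i := 0, i + 1 := 1) else \<eta>)"

definition jump_left :: "int \<Rightarrow> (int \<Rightarrow> nat) \<Rightarrow> int \<Rightarrow> nat" where
  "jump_left i \<eta> = (if \<eta> i = 0 \<and> \<eta> (i + 1) = 1 then \<eta>(i := 1, i + 1 := 0) else \<eta>)"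

lemma finite_configs: "finite (configs m n)"
  unfolding configs_def by (rule finite_PiE) auto

lemma configs_values: "\<eta> \<in> configs m n \<Longrightarrow> m \<le> x \<Longrightarrow> x \<le> n \<Longrightarrow> \<eta> x = 0 \<or> \<eta> x = 1"
  by (auto simp: configs_def PiE_iff)

lemma configs_update:
  "\<eta> \<in> configs m n \<Longrightarrow> m \<le> x \<Longrightarrow> x \<le> n \<Longrightarrow> v = 0 \<or> v = 1 \<Longrightarrow> \<eta>(x := v) \<in> configs m n"
  by (auto simp: configs_def PiE_iff extensional_def)

lemma sum_bonds:
  fixes F :: "int \<Rightarrow> real"
  shows "(\<Sum>i\<in>{m - 1..n}. F i) = (\<Sum>i\<in>{m..<n}. F i) + F (m - 1) + F n"
proof -
  have "{m - 1..n} = insert (m - 1) (insert n {m..<n})" using m_less_n by auto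
  then show ?thesis using m_less_n by simp
qed

text \<open>The generator, applied to a function \<open>g\<close> of the configuration, written as a sum over moves.\<close>

lemma sum_excl_generator:
  fixes g :: "(int \<Rightarrow> nat) \<Rightarrow> real"
  assumes \<eta>: "\<eta> \<in> configs m n"
  shows "(\<Sum>\<zeta>\<in>configs m n. excl_generator m n p \<eta> \<zeta> * g \<zeta>) =
    (\<Sum>i\<in>{m - 1..n}. p i * (g (jump_right i \<eta>) - g \<eta>)) +
    (\<Sum>i\<in>{m..<n}. (1 - p (i + 1)) * (g (jump_left i \<eta>) - g \<eta>))"
proof -
  let ?C = "configs m n"
  let ?G = "\<lambda>\<zeta>. g \<zeta> - g \<eta>"
  have pick: "(\<Sum>\<zeta>\<in>?C. (if P \<and> \<zeta> = \<theta> then c else 0) * ?G \<zeta>) = (if P then c * ?G \<theta> else 0)"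
    if "P \<Longrightarrow> \<theta> \<in> ?C" for P \<theta> and c :: real
  proof (cases P)
    case True
    then have "(\<Sum>\<zeta>\<in>?C. (if P \<and> \<zeta> = \<theta> then c else 0) * ?G \<zeta>)
        = (\<Sum>\<zeta>\<in>?C. if \<zeta> = \<theta> then c * ?G \<zeta> else 0)"
      by (intro sum.cong) auto
    with that True show ?thesis by (simp add: finite_configs)
  qed simp
  have "(\<Sum>\<zeta>\<in>?C. excl_generator m n p \<eta> \<zeta> * g \<zeta>) =
      excl_generator m n p \<eta> \<eta> * g \<eta> + (\<Sum>\<zeta>\<in>?C - {\<eta>}. excl_generator m n p \<eta> \<zeta> * g \<zeta>)"
    by (rule sum.remove) (use \<eta> finite_configs in auto)
  also have "(\<Sum>\<zeta>\<in>?C - {\<eta>}. excl_generator m n p \<eta> \<zeta> * g \<zeta>)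
      = (\<Sum>\<zeta>\<in>?C - {\<eta>}. excl_rate m n p \<eta> \<zeta> * g \<zeta>)"
    by (intro sum.cong) (auto simp: excl_generator_def)
  also have "excl_generator m n p \<eta> \<eta> * g \<eta> + \<dots> = (\<Sum>\<zeta>\<in>?C - {\<eta>}. excl_rate m n p \<eta> \<zeta> * ?G \<zeta>)"
    by (simp add: excl_generator_def right_diff_distrib sum_subtractf sum_distrib_right)
  also have "\<dots> = (\<Sum>\<zeta>\<in>?C. excl_rate m n p \<eta> \<zeta> * ?G \<zeta>)"
    by (subst sum.remove[of ?C \<eta>]) (use \<eta> finite_configs in auto)
  also have "\<dots> =
      (\<Sum>i\<in>{m..<n}.
        (\<Sum>\<zeta>\<in>?C. (if (\<eta> i = 1 \<and> \<eta> (i + 1) = 0) \<and> \<zeta> = \<eta>(i := 0, i + 1 := 1) then p i else 0) * ?G \<zeta>)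
      + (\<Sum>\<zeta>\<in>?C. (if (\<eta> i = 0 \<and> \<eta> (i + 1) = 1) \<and> \<zeta> = \<eta>(i := 1, i + 1 := 0)
           then 1 - p (i + 1) else 0) * ?G \<zeta>))
    + (\<Sum>\<zeta>\<in>?C. (if \<eta> m = 0 \<and> \<zeta> = \<eta>(m := 1) then p (m - 1) else 0) * ?G \<zeta>)
    + (\<Sum>\<zeta>\<in>?C. (if \<eta> n = 1 \<and> \<zeta> = \<eta>(n := 0) then p n else 0) * ?G \<zeta>)"
    unfolding excl_rate_def distrib_right sum.distrib sum_distrib_right conj_assoc
    by (subst (1 2) sum.swap[of _ "{m..<n}"]) (rule refl)
  also have "\<dots> =
      (\<Sum>i\<in>{m..<n}. p i * ?G (jump_right i \<eta>) + (1 - p (i + 1)) * ?G (jump_left i \<eta>))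
    + p (m - 1) * ?G (jump_right (m - 1) \<eta>) + p n * ?G (jump_right n \<eta>)"
  proof (intro arg_cong2[where f = "(+)"] sum.cong refl)
    fix i assume i: "i \<in> {m..<n}"
    show "(\<Sum>\<zeta>\<in>?C. (if (\<eta> i = 1 \<and> \<eta> (i + 1) = 0) \<and> \<zeta> = \<eta>(i := 0, i + 1 := 1) then p i else 0) * ?G \<zeta>)
        = p i * ?G (jump_right i \<eta>)"
      by (subst pick) (use i \<eta> in \<open>auto intro!: configs_update simp: jump_right_def\<close>)
    show "(\<Sum>\<zeta>\<in>?C. (if (\<eta> i = 0 \<and> \<eta> (i + 1) = 1) \<and> \<zeta> = \<eta>(i := 1, i + 1 := 0)
           then 1 - p (i + 1) else 0) * ?G \<zeta>) = (1 - p (i + 1)) * ?G (jump_left i \<eta>)"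
      by (subst pick) (use i \<eta> in \<open>auto intro!: configs_update simp: jump_left_def\<close>)
  next
    show "(\<Sum>\<zeta>\<in>?C. (if \<eta> m = 0 \<and> \<zeta> = \<eta>(m := 1) then p (m - 1) else 0) * ?G \<zeta>)
        = p (m - 1) * ?G (jump_right (m - 1) \<eta>)"
      by (subst pick) (use m_less_n \<eta> in \<open>auto intro!: configs_update simp: jump_right_def\<close>)
    show "(\<Sum>\<zeta>\<in>?C. (if \<eta> n = 1 \<and> \<zeta> = \<eta>(n := 0) then p n else 0) * ?G \<zeta>)
        = p n * ?G (jump_right n \<eta>)"
      by (subst pick) (use m_less_n \<eta> in \<open>auto intro!: configs_update simp: jump_right_def\<close>)
  qed
  also have "\<dots> = (\<Sum>i\<in>{m - 1..n}. p i * ?G (jump_right i \<eta>)) +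
    (\<Sum>i\<in>{m..<n}. (1 - p (i + 1)) * ?G (jump_left i \<eta>))"
    by (simp add: sum_bonds sum.distrib)
  finally show ?thesis .
qed

lemma stationary_sum_generator:
  assumes "stationary_distribution m n p \<mu>"
  shows "(\<Sum>\<eta>\<in>configs m n. pmf \<mu> \<eta> * (\<Sum>\<zeta>\<in>configs m n. excl_generator m n p \<eta> \<zeta> * g \<zeta>)) = 0"
proof -
  have "(\<Sum>\<eta>\<in>configs m n. pmf \<mu> \<eta> * (\<Sum>\<zeta>\<in>configs m n. excl_generator m n p \<eta> \<zeta> * g \<zeta>))
      = (\<Sum>\<eta>\<in>configs m n. \<Sum>\<zeta>\<in>configs m n. pmf \<mu> \<eta> * excl_generator m n p \<eta> \<zeta> * g \<zeta>)"
    by (simp add: sum_distrib_left mult.assoc)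
  also have "\<dots> = (\<Sum>\<zeta>\<in>configs m n. (\<Sum>\<eta>\<in>configs m n. pmf \<mu> \<eta> * excl_generator m n p \<eta> \<zeta>) * g \<zeta>)"
    by (subst sum.swap) (simp add: sum_distrib_right)
  also have "\<dots> = 0"
    using assms by (simp add: stationary_distribution_def)
  finally show ?thesis .
qed

section \<open>The height of a configuration and its growth in the stationary state\<close>

text \<open>The height function of \<open>\<eta>\<close> with the normalization \<open>height r \<eta> r = 0\<close>.\<close>

definition height :: "int \<Rightarrow> (int \<Rightarrow> nat) \<Rightarrow> int \<Rightarrow> int" where
  "height r \<eta> x = (\<Sum>l\<in>{m..r}. int (\<eta> l)) - (\<Sum>l\<in>{m..x}. int (\<eta> l))"

lemma sum_update:
  "(\<Sum>l\<in>{m..x}. int ((\<eta>(a := v)) l)) =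
    (\<Sum>l\<in>{m..x}. int (\<eta> l)) + (if m \<le> a \<and> a \<le> x then int v - int (\<eta> a) else 0)"
proof (cases "a \<in> {m..x}")
  case True
  then show ?thesis
    by (simp add: sum.remove[of "{m..x}" a])
next
  case False
  then have "(\<Sum>l\<in>{m..x}. int ((\<eta>(a := v)) l)) = (\<Sum>l\<in>{m..x}. int (\<eta> l))"
    by (intro sum.cong) auto
  with False show ?thesis by auto
qed

lemma height_update:
  "height r (\<eta>(a := v)) x = height r \<eta> x + (if m \<le> a \<and> a \<le> r then int v - int (\<eta> a) else 0)
    - (if m \<le> a \<and> a \<le> x then int v - int (\<eta> a) else 0)"
  unfolding height_def sum_update by simp

lemma height_pred: "m \<le> x \<Longrightarrow> height r \<eta> (x - 1) = height r \<eta> x + int (\<eta> x)"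
proof -
  assume "m \<le> x"
  then have "{m..x} = insert x {m..x - 1}" by auto
  then show ?thesis by (simp add: height_def)
qed

lemma height_succ: "m \<le> x + 1 \<Longrightarrow> height r \<eta> (x + 1) = height r \<eta> x - int (\<eta> (x + 1))"
  using height_pred[of "x + 1" r \<eta>] by simp

text \<open>
  A crossing of the bond \<open>(r, r + 1)\<close> changes the height at which the normalization takes place, which
  amounts to a vertical shift by one. For all other moves the normalization stays the same.
\<close>

lemma observable_up_height:
  assumes f: "observable f" and \<eta>: "\<eta> \<in> configs m n"
    and i: "m - 1 \<le> i" "i \<le> n" and r: "m \<le> r" "r < n"
  shows "f (up i (height r \<eta>)) =
    f (height r (jump_right i \<eta>)) + (if i = r \<and> \<eta> r = 1 \<and> \<eta> (r + 1) = 0 then 1 else 0)"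
proof -
  let ?c = "if i = r \<and> \<eta> r = 1 \<and> \<eta> (r + 1) = 0 then 1 else 0 :: int"
  have "up i (height r \<eta>) x = height r (jump_right i \<eta>) x + ?c"
    if x: "m - 1 \<le> x" "x \<le> n" for x
  proof -
    consider "i = m - 1" | "i = n" | "m \<le> i" "i < n" using i by linarith
    then show ?thesis
    proof cases
      case 1
      with configs_values[OF \<eta>, of m] height_pred[of m r \<eta>] m_less_n r x show ?thesis
        by (auto simp: up_def jump_right_def height_update)
    next
      case 2
      with configs_values[OF \<eta>, of n] height_pred[of n r \<eta>] m_less_n r x show ?thesis
        by (auto simp: up_def jump_right_def height_update)
    next
      case 3
      with configs_values[OF \<eta>, of i] configs_values[OF \<eta>, of "i + 1"]
      have "up i (height r \<eta>) =
        (if \<eta> i = 1 \<and> \<eta> (i + 1) = 0 then (height r \<eta>)(i := height r \<eta> i + 1) else height r \<eta>)"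
        by (auto simp: up_def height_pred height_succ)
      with 3 r x show ?thesis
        by (cases i r rule: linorder_cases) (auto simp: jump_right_def height_update)
    qed
  qed
  from observable_eq[OF f this] show ?thesis by simp
qed

lemma observable_down_height:
  assumes f: "observable f" and \<eta>: "\<eta> \<in> configs m n"
    and i: "m \<le> i" "i < n" and r: "m \<le> r" "r < n"
  shows "f (down i (height r \<eta>)) =
    f (height r (jump_left i \<eta>)) - (if i = r \<and> \<eta> r = 0 \<and> \<eta> (r + 1) = 1 then 1 else 0)"
proof -
  let ?c = "if i = r \<and> \<eta> r = 0 \<and> \<eta> (r + 1) = 1 then - 1 else 0 :: int"
  have "down i (height r \<eta>) x = height r (jump_left i \<eta>) x + ?c"
    if x: "m - 1 \<le> x" "x \<le> n" for x
  proof -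
    from i configs_values[OF \<eta>, of i] configs_values[OF \<eta>, of "i + 1"]
    have "down i (height r \<eta>) =
      (if \<eta> i = 0 \<and> \<eta> (i + 1) = 1 then (height r \<eta>)(i := height r \<eta> i - 1) else height r \<eta>)"
      by (auto simp: down_def height_pred height_succ)
    with i r x show ?thesis
      by (cases i r rule: linorder_cases) (auto simp: jump_left_def height_update)
  qed
  from observable_eq[OF f this] show ?thesis by simp
qed

text \<open>
  One step changes \<open>f\<close> by a generator term, whose stationary expectation vanishes, and by the
  net rate of crossings of the bond \<open>(r, r + 1)\<close>, whose expectation is the flux.
\<close>

lemma step_height:
  assumes f: "observable f" and \<eta>: "\<eta> \<in> configs m n" and r: "m \<le> r" "r < n"
  shows "num_moves * (step p f (height r \<eta>) - f (height r \<eta>)) =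
    (\<Sum>\<zeta>\<in>configs m n. excl_generator m n p \<eta> \<zeta> * f (height r \<zeta>))
    + p r * (if \<eta> r = 1 \<and> \<eta> (r + 1) = 0 then 1 else 0)
    - (1 - p (r + 1)) * (if \<eta> r = 0 \<and> \<eta> (r + 1) = 1 then 1 else 0)"
proof -
  let ?h = "height r \<eta>"
  let ?a = "if \<eta> r = 1 \<and> \<eta> (r + 1) = 0 then 1 else 0 :: real"
  let ?b = "if \<eta> r = 0 \<and> \<eta> (r + 1) = 1 then 1 else 0 :: real"
  have "num_moves * (step p f ?h - f ?h) =
      (\<Sum>i\<in>{m - 1..n}. p i * (f (up i ?h) - f ?h))
      + (\<Sum>i\<in>{m..<n}. (1 - p (i + 1)) * (f (down i ?h) - f ?h))"
  proof -
    have "(\<Sum>i\<in>{m - 1..n}. (1 - p i) * f ?h + p i * f (up i ?h))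
        = (\<Sum>i\<in>{m - 1..n}. f ?h + p i * (f (up i ?h) - f ?h))"
      by (simp add: algebra_simps)
    moreover have "(\<Sum>i\<in>{m..<n}. p (i + 1) * f ?h + (1 - p (i + 1)) * f (down i ?h))
        = (\<Sum>i\<in>{m..<n}. f ?h + (1 - p (i + 1)) * (f (down i ?h) - f ?h))"
      by (simp add: algebra_simps)
    moreover have "(\<Sum>i\<in>{m - 1..n}. f ?h) + (\<Sum>i\<in>{m..<n}. f ?h) = num_moves * f ?h"
      using m_less_n by (simp add: num_moves_def algebra_simps)
    moreover have "num_moves * step p f ?h =
        (\<Sum>i\<in>{m - 1..n}. (1 - p i) * f ?h + p i * f (up i ?h)) +
        (\<Sum>i\<in>{m..<n}. p (i + 1) * f ?h + (1 - p (i + 1)) * f (down i ?h))"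
      using num_moves_pos by (simp add: step_def)
    ultimately show ?thesis
      by (simp only: sum.distrib right_diff_distrib[of num_moves])
  qed
  also have "(\<Sum>i\<in>{m - 1..n}. p i * (f (up i ?h) - f ?h)) =
      (\<Sum>i\<in>{m - 1..n}. p i * (f (height r (jump_right i \<eta>)) - f ?h) + (if i = r then p r * ?a else 0))"
    by (intro sum.cong refl) (auto simp: observable_up_height[OF f \<eta> _ _ r] algebra_simps)
  also have "\<dots> = (\<Sum>i\<in>{m - 1..n}. p i * (f (height r (jump_right i \<eta>)) - f ?h)) + p r * ?a"
    using r by (simp only: sum.distrib sum.delta' sum.delta finite_atLeastAtMost_int) simp
  also have "(\<Sum>i\<in>{m..<n}. (1 - p (i + 1)) * (f (down i ?h) - f ?h)) =
      (\<Sum>i\<in>{m..<n}. (1 - p (i + 1)) * (f (height r (jump_left i \<eta>)) - f ?h)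
         - (if i = r then (1 - p (r + 1)) * ?b else 0))"
    by (intro sum.cong refl) (auto simp: observable_down_height[OF f \<eta> _ _ r] algebra_simps)
  also have "\<dots> = (\<Sum>i\<in>{m..<n}. (1 - p (i + 1)) * (f (height r (jump_left i \<eta>)) - f ?h))
      - (1 - p (r + 1)) * ?b"
    using r by (simp only: sum_subtractf sum.delta' sum.delta finite_atLeastLessThan_int) simp
  finally show ?thesis
    by (simp only: sum_excl_generator[OF \<eta>, of p "\<lambda>\<zeta>. f (height r \<zeta>)"])
qed

lemma prob_eq_sum:
  assumes "set_pmf \<mu> \<subseteq> configs m n"
  shows "measure_pmf.prob \<mu> {\<eta>. P \<eta>} = (\<Sum>\<eta>\<in>configs m n. pmf \<mu> \<eta> * (if P \<eta> then 1 else 0))"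
proof -
  have "measure_pmf.prob \<mu> {\<eta>. P \<eta>} = measure_pmf.prob \<mu> {\<eta> \<in> configs m n. P \<eta>}"
    by (intro measure_pmf.finite_measure_eq_AE AE_pmfI) (use assms in auto)
  also have "\<dots> = (\<Sum>\<eta>\<in>{\<eta> \<in> configs m n. P \<eta>}. pmf \<mu> \<eta>)"
    by (rule measure_measure_pmf_finite) (simp add: finite_configs)
  also have "\<dots> = (\<Sum>\<eta>\<in>configs m n. pmf \<mu> \<eta> * (if P \<eta> then 1 else 0))"
    by (subst sum.inter_filter[OF finite_configs]) (intro sum.cong, auto)
  finally show ?thesis .
qed

lemma stationary_step:
  assumes st: "stationary_distribution m n p \<mu>" and f: "observable f" and r: "m \<le> r" "r < n"
  shows "(\<Sum>\<eta>\<in>configs m n. pmf \<mu> \<eta> * step p f (height r \<eta>)) =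
    (\<Sum>\<eta>\<in>configs m n. pmf \<mu> \<eta> * f (height r \<eta>)) + flux p \<mu> r / num_moves"
proof -
  let ?C = "configs m n"
  have supp: "set_pmf \<mu> \<subseteq> ?C" using st by (simp add: stationary_distribution_def)
  have "num_moves * ((\<Sum>\<eta>\<in>?C. pmf \<mu> \<eta> * step p f (height r \<eta>)) - (\<Sum>\<eta>\<in>?C. pmf \<mu> \<eta> * f (height r \<eta>)))
      = (\<Sum>\<eta>\<in>?C. pmf \<mu> \<eta> * (num_moves * (step p f (height r \<eta>) - f (height r \<eta>))))"
    by (simp add: sum_subtractf[symmetric] sum_distrib_left algebra_simps)
  also have "\<dots> = (\<Sum>\<eta>\<in>?C. pmf \<mu> \<eta> * (\<Sum>\<zeta>\<in>?C. excl_generator m n p \<eta> \<zeta> * f (height r \<zeta>))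
      + p r * (pmf \<mu> \<eta> * (if \<eta> r = 1 \<and> \<eta> (r + 1) = 0 then 1 else 0))
      - (1 - p (r + 1)) * (pmf \<mu> \<eta> * (if \<eta> r = 0 \<and> \<eta> (r + 1) = 1 then 1 else 0)))"
    by (intro sum.cong refl) (simp only: step_height[OF f _ r], simp add: algebra_simps)
  also have "\<dots> = flux p \<mu> r"
    unfolding flux_def prob_eq_sum[OF supp]
    by (simp only: sum.distrib sum_subtractf sum_distrib_left[symmetric] stationary_sum_generator[OF st])
  finally show ?thesis using num_moves_pos by (simp add: field_simps)
qed

lemma expectation_mean_height:
  assumes st: "stationary_distribution m n p \<mu>" and r: "m \<le> r" "r < n"
    and p: "\<And>i. m - 1 \<le> i \<Longrightarrow> i \<le> n \<Longrightarrow> p i \<in> {0<..<1}"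
  shows "(\<Sum>\<eta>\<in>configs m n. pmf \<mu> \<eta> * mean_height p t (height r \<eta>)) =
    (\<Sum>\<eta>\<in>configs m n. pmf \<mu> \<eta> * of_int (height r \<eta> m)) + t * (flux p \<mu> r / num_moves)"
proof (induction t)
  case 0
  show ?case by (simp add: mean_height_def)
next
  case (Suc t)
  have "(\<Sum>\<eta>\<in>configs m n. pmf \<mu> \<eta> * mean_height p (Suc t) (height r \<eta>)) =
    (\<Sum>\<eta>\<in>configs m n. pmf \<mu> \<eta> * mean_height p t (height r \<eta>)) + flux p \<mu> r / num_moves"
    unfolding mean_height_Suc by (rule stationary_step[OF st observable_mean_height[OF p] r])
  then show ?case by (simp only: Suc of_nat_Suc algebra_simps)
qed

lemma height_bounds:
  assumes \<eta>: "\<eta> \<in> configs m n" and "m - 1 \<le> r" "r \<le> n" "m - 1 \<le> x" "x \<le> n"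
  shows "\<bar>height r \<eta> x\<bar> \<le> n - m + 1"
proof -
  have "0 \<le> (\<Sum>l\<in>{m..y}. int (\<eta> l)) \<and> (\<Sum>l\<in>{m..y}. int (\<eta> l)) \<le> n - m + 1"
    if "m - 1 \<le> y" "y \<le> n" for y
  proof -
    have "(\<Sum>l\<in>{m..y}. int (\<eta> l)) \<le> (\<Sum>l\<in>{m..y}. 1)"
      by (intro sum_mono) (use configs_values[OF \<eta>] that in force)
    with that show ?thesis by (simp add: sum_nonneg)
  qed
  from this[of r] this[of x] assms show ?thesis by (auto simp: height_def)
qed

end

section \<open>Comparison of the fluxes\<close>

lemma weighted_sum_le:
  fixes w v a b :: "'a \<Rightarrow> real"
  assumes "sum w S = 1" "sum v S = 1" "\<And>x. x \<in> S \<Longrightarrow> w x \<ge> 0" "\<And>x. x \<in> S \<Longrightarrow> v x \<ge> 0"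
    and "\<And>x y. x \<in> S \<Longrightarrow> y \<in> S \<Longrightarrow> a x \<le> b y + c"
  shows "(\<Sum>x\<in>S. w x * a x) \<le> (\<Sum>x\<in>S. v x * b x) + c"
proof -
  have "(\<Sum>x\<in>S. w x * a x) \<le> b y + c" if "y \<in> S" for y
  proof -
    have "(\<Sum>x\<in>S. w x * a x) \<le> (\<Sum>x\<in>S. w x * (b y + c))"
      by (intro sum_mono mult_left_mono) (use assms that in auto)
    also have "\<dots> = b y + c" using assms(1) by (simp only: sum_distrib_right[symmetric]) simp
    finally show ?thesis .
  qed
  then have "(\<Sum>y\<in>S. v y * (\<Sum>x\<in>S. w x * a x)) \<le> (\<Sum>y\<in>S. v y * (b y + c))"
    by (intro sum_mono mult_left_mono) (use assms in auto)
  then show ?thesis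
    using assms(2) by (simp add: sum_distrib_right[symmetric] distrib_left sum.distrib)
qed

theorem theorem2:
  fixes m n j k :: int and p p' :: "int \<Rightarrow> real" and \<mu> \<mu>' :: "(int \<Rightarrow> nat) pmf"
  assumes "m < n"
    and "\<And>i. m - 1 \<le> i \<Longrightarrow> i \<le> n \<Longrightarrow> p i \<in> {0<..<1}"
    and "\<And>i. m - 1 \<le> i \<Longrightarrow> i \<le> n \<Longrightarrow> p' i \<in> {0<..<1}"
    and "\<And>i. m - 1 \<le> i \<Longrightarrow> i \<le> n \<Longrightarrow> p i \<le> p' i"
    and "stationary_distribution m n p \<mu>"
    and "stationary_distribution m n p' \<mu>'"
    and "m \<le> j" and "j < n" and "m \<le> k" and "k < n"
  shows "flux p \<mu> j \<le> flux p' \<mu>' k"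
proof -
  interpret height_process m n by unfold_locales fact
  let ?C = "configs m n"
  \<comment> \<open>By \<open>height_bounds\<close>, the heights of two configurations differ by at most \<open>c\<close>.\<close>
  define c where "c = 2 * (n - m + 1)"
  define A where "A = (\<Sum>\<eta>\<in>?C. pmf \<mu> \<eta> * of_int (height j \<eta> m))"
  define B where "B = (\<Sum>\<eta>\<in>?C. pmf \<mu>' \<eta> * of_int (height k \<eta> m))"
  have total: "(\<Sum>\<eta>\<in>?C. pmf \<nu> \<eta>) = 1" if "stationary_distribution m n q \<nu>" for q \<nu>
    using that by (intro sum_pmf_eq_1 finite_configs) (simp add: stationary_distribution_def)
  have growth: "A + t * (flux p \<mu> j / num_moves) \<le> B + t * (flux p' \<mu>' k / num_moves) + c" for t :: nat
  proof -
    have "mean_height p t (height j \<eta>) \<le> mean_height p' t (height k \<zeta>) + c"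
      if "\<eta> \<in> ?C" "\<zeta> \<in> ?C" for \<eta> \<zeta>
    proof -
      have obs: "observable (mean_height p' t)" using assms(3) by (rule observable_mean_height)
      have "height j \<eta> x \<le> height k \<zeta> x + c" if "x \<in> {m - 1..n}" for x
        using height_bounds[OF \<open>\<eta> \<in> ?C\<close>, of j x] height_bounds[OF \<open>\<zeta> \<in> ?C\<close>, of k x] that assms(7-10)
        by (simp add: c_def)
      then have "height j \<eta> \<sqsubseteq> (\<lambda>x. height k \<zeta> x + c)" by (simp add: height_le_def)
      from observable_mono[OF obs this]
      have "mean_height p' t (height j \<eta>) \<le> mean_height p' t (height k \<zeta>) + c"
        by (simp add: observable_shift[OF obs])
      moreover have "mean_height p t (height j \<eta>) \<le> mean_height p' t (height j \<eta>)"
        using assms(2-4) by (rule mean_height_le)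
      ultimately show ?thesis by linarith
    qed
    then have "(\<Sum>\<eta>\<in>?C. pmf \<mu> \<eta> * mean_height p t (height j \<eta>))
        \<le> (\<Sum>\<eta>\<in>?C. pmf \<mu>' \<eta> * mean_height p' t (height k \<eta>)) + c"
      by (intro weighted_sum_le total[OF assms(5)] total[OF assms(6)]) auto
    then show ?thesis
      unfolding A_def B_def
      using expectation_mean_height[OF assms(5,7,8,2), of t] expectation_mean_height[OF assms(6,9,10,3), of t]
      by simp
  qed
  show ?thesis
  proof (rule ccontr)
    assume "\<not> flux p \<mu> j \<le> flux p' \<mu>' k"
    then have "(flux p \<mu> j - flux p' \<mu>' k) / num_moves > 0" using num_moves_pos by simp
    then obtain t :: nat where "B + c - A < t * ((flux p \<mu> j - flux p' \<mu>' k) / num_moves)"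
      using reals_Archimedean3 by blast
    with growth[of t] show False by (simp add: diff_divide_distrib right_diff_distrib)
  qed
qed

end
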